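(* Let $\eta_1,\dots,\eta_N>0$ and let $\Phi$ be the (smoothed) Burg entropy $\Phi(x):=\sum_{i=1}^N-\log(x_i+\eta_i)$. Let $K\in\{1,\dots,N\}$. Assume that the matrix $\tilde A\in\mathbb R_{\ge0}^{\#\sigma_y\times N}$, which is the restriction of $A$ to the rows indexed by $\sigma_y:=\{j: y_j\ne0\}$, satisfies (LRIP) for $K$ with constant $\delta_K^-<1$. Assume in addition that $\mathcal X\subset\mathbb R_{\ge0}^N$ is a compact set. Then there exists $C_K>0$ such that (BRSC) holds for $F=G_y^{\mathrm{KL}}(A\,\cdot)$ with respect to $\Phi$, $\mathcal X$ and $K$, i.e. $$D_F^{\mathrm{symm}}(x,x')\ge C_K\,D_\Phi^{\mathrm{symm}}(x,x')$$ for all $x\in\mathcal X$ and all $x'\in\mathbb R_{\ge0}^N$ with $x'\ne x$ and $\|x-x'\|_0\le K$.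
   Context: $\|x\|_0$ is the number of nonzero entries of $x$. Setting (Poisson regression): $A\in\mathbb R_{\ge0}^{M\times N}$ has no column entirely zero, $b\in\mathbb R_{>0}^M$, $y\in\mathbb Z_{\ge0}^M$, and for $w\in\mathbb R_{\ge0}^M$ $$G_y^{\mathrm{KL}}(w)=\sum_{j=1}^M g^{\mathrm{KL}}_{y_j}(w_j+b_j),\qquad g_y^{\mathrm{KL}}(z)=z+y\log(y/z)-y\quad(0\log0=0).$$ Symmetric Bregman divergence: $D_H^{\mathrm{symm}}(x,x')=\langle\nabla H(x')-\nabla H(x),x'-x\rangle$. (LRIP): a matrix $B$ with $N$ columns satisfies (LRIP) for $K$ with constant $\delta_K^-<1$ if $B_\omega^TB_\omega\succcurlyeq(1-\delta_K^-)\mathrm{Id}$ for all $\omega\subseteq\{1,\dots,N\}$ with $\#\omega\le K$, where $B_\omega$ is the submatrix of columns indexed by $\omega$ and $\succcurlyeq$ is the Loewner order. *)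

theory Defs
  imports "HOL-Analysis.Analysis"
begin

text \<open>Matrices obtained by deleting rows or columns have index sets that depend on the data
  (the support of a vector, an arbitrary set of columns).  They are represented by an entry
  function together with explicit finite sets of row and column indices; passing to the submatrix
  with rows \<open>R\<close> and columns \<open>\<omega>\<close> means replacing the index sets.\<close>

definition gram_on :: "'r set \<Rightarrow> ('r \<Rightarrow> 'c \<Rightarrow> real) \<Rightarrow> 'c \<Rightarrow> 'c \<Rightarrow> real" where
  \<comment> \<open>entries of \<open>B\<^sup>T B\<close> for a matrix \<open>B\<close> with row set \<open>R\<close>\<close>
  "gram_on R B i k = (\<Sum>j\<in>R. B j i * B j k)"

definition pos_semidef_on :: "'c set \<Rightarrow> ('c \<Rightarrow> 'c \<Rightarrow> real) \<Rightarrow> bool" where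
  "pos_semidef_on I P \<longleftrightarrow>
     (\<forall>i\<in>I. \<forall>k\<in>I. P i k = P k i) \<and>
     (\<forall>v. 0 \<le> (\<Sum>i\<in>I. \<Sum>k\<in>I. v i * P i k * v k))"

definition loewner_ge_on :: "'c set \<Rightarrow> ('c \<Rightarrow> 'c \<Rightarrow> real) \<Rightarrow> ('c \<Rightarrow> 'c \<Rightarrow> real) \<Rightarrow> bool" where
  "loewner_ge_on I P Q \<longleftrightarrow> pos_semidef_on I (\<lambda>i k. P i k - Q i k)"

definition LRIP :: "'r set \<Rightarrow> 'c set \<Rightarrow> ('r \<Rightarrow> 'c \<Rightarrow> real) \<Rightarrow> nat \<Rightarrow> real \<Rightarrow> bool" where
  \<comment> \<open>\<open>B\<close> has row set \<open>R\<close> and column set \<open>S\<close>, both finite\<close>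
  "LRIP R S B K \<delta> \<longleftrightarrow> \<delta> < 1 \<and>
     (\<forall>\<omega>. \<omega> \<subseteq> S \<and> card \<omega> \<le> K \<longrightarrow>
        loewner_ge_on \<omega> (gram_on R B) (\<lambda>i k. (1 - \<delta>) * (if i = k then 1 else 0)))"

definition grad :: "('a::real_inner \<Rightarrow> real) \<Rightarrow> 'a \<Rightarrow> 'a" where
  "grad H x = (THE D. GDERIV H x :> D)"

definition D_symm :: "('a::real_inner \<Rightarrow> real) \<Rightarrow> 'a \<Rightarrow> 'a \<Rightarrow> real" where
  "D_symm H x x' = (grad H x' - grad H x) \<bullet> (x' - x)"

definition l0_norm :: "real ^ 'n \<Rightarrow> nat" where
  "l0_norm x = card {i. x $ i \<noteq> 0}"

definition nonneg_orthant :: "(real ^ 'n) set" where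
  "nonneg_orthant = {x. \<forall>i. 0 \<le> x $ i}"

definition g_KL :: "nat \<Rightarrow> real \<Rightarrow> real" where
  \<comment> \<open>for \<open>y = 0\<close> the logarithmic term vanishes, which is the convention \<open>0 log 0 = 0\<close>\<close>
  "g_KL y z = z + real y * ln (real y / z) - real y"

definition G_KL :: "nat ^ 'm \<Rightarrow> real ^ 'm \<Rightarrow> real ^ 'm \<Rightarrow> real" where
  "G_KL y b w = (\<Sum>j\<in>UNIV. g_KL (y $ j) (w $ j + b $ j))"

definition burg_entropy :: "real ^ 'n \<Rightarrow> real ^ 'n \<Rightarrow> real" where
  "burg_entropy \<eta> x = (\<Sum>i\<in>UNIV. - ln (x $ i + \<eta> $ i))"

definition BRSC ::
  "(real ^ 'n \<Rightarrow> real) \<Rightarrow> (real ^ 'n \<Rightarrow> real) \<Rightarrow> (real ^ 'n) set \<Rightarrow> nat \<Rightarrow> real \<Rightarrow> bool" where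
  "BRSC F \<Phi> X K C \<longleftrightarrow>
     (\<forall>x\<in>X. \<forall>x'\<in>nonneg_orthant. x' \<noteq> x \<and> l0_norm (x - x') \<le> K \<longrightarrow>
        D_symm F x x' \<ge> C * D_symm \<Phi> x x')"

text \<open>The functions above are smooth on an open neighbourhood of the nonnegative orthant, so the
  two-sided derivative used in \<open>grad\<close> exists on the whole orthant, boundary included.
  By the following lemma \<open>grad\<close> is then the gradient.\<close>

lemma grad_eqI:
  assumes "GDERIV H x :> D"
  shows "grad H x = D"
  unfolding grad_def
proof (rule the_equality)
  fix D' assume "GDERIV H x :> D'"
  then have "(\<lambda>h. h \<bullet> D') = (\<lambda>h. h \<bullet> D)"
    using assms has_derivative_unique unfolding gderiv_def by blast
  then show "D' = D"
    by (metis vector_eq_ldot)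
qed (fact assms)

end

theory Submission
  imports Defs
begin

text \<open>Put \<open>h = x' - x\<close> and \<open>t = \<parallel>h\<parallel>\<close>. Both divergences are explicit:
  \<open>D\<^sub>F = \<Sum>\<^sub>j y\<^sub>j (A h)\<^sub>j\<^sup>2 / ((A x + b)\<^sub>j (A x' + b)\<^sub>j)\<close> and
  \<open>D\<^sub>\<Phi> = \<Sum>\<^sub>i h\<^sub>i\<^sup>2 / ((x\<^sub>i + \<eta>\<^sub>i) (x'\<^sub>i + \<eta>\<^sub>i))\<close>.
  As \<open>x\<close> ranges over a bounded set, \<open>(A x' + b)\<^sub>j\<close> is at most of order \<open>1 + t\<close>, while
  \<open>x'\<^sub>i + \<eta>\<^sub>i\<close> is at least of order \<open>1 + \<bar>h\<^sub>i\<bar>\<close>. Hence \<open>D\<^sub>F\<close> is bounded below, using (LRIP), and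
  \<open>D\<^sub>\<Phi>\<close> above, by a multiple of \<open>t\<^sup>2 / (1 + t)\<close>.\<close>

section \<open>Closed forms of the two divergences\<close>

lemma GDERIV_sum_affine:
  fixes A :: "real ^ 'n ^ 'm" and c :: "real ^ 'm"
  assumes "\<And>j. (f j has_real_derivative f' j) (at ((A *v x) $ j + c $ j))"
  shows "GDERIV (\<lambda>x. \<Sum>j\<in>UNIV. f j ((A *v x) $ j + c $ j)) x :> transpose A *v (\<chi> j. f' j)"
proof -
  have aff: "((\<lambda>x. (A *v x) $ j + c $ j) has_derivative (\<lambda>h. (A *v h) $ j)) (at x)" for j
  proof -
    have "bounded_linear (\<lambda>h. (A *v h) $ j)"
      by (intro bounded_linear_compose[OF bounded_linear_vec_nth] matrix_vector_mul_bounded_linear)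
    then show ?thesis
      by (auto intro!: has_derivative_add_const bounded_linear_imp_has_derivative)
  qed
  have "((\<lambda>x. f j ((A *v x) $ j + c $ j)) has_derivative (\<lambda>h. f' j * (A *v h) $ j)) (at x)" for j
    using has_derivative_compose[OF aff assms[unfolded has_field_derivative_def]] by simp
  then have "((\<lambda>x. \<Sum>j\<in>UNIV. f j ((A *v x) $ j + c $ j)) has_derivative
      (\<lambda>h. \<Sum>j\<in>UNIV. f' j * (A *v h) $ j)) (at x)"
    by (intro has_derivative_sum)
  moreover have "(\<Sum>j\<in>UNIV. f' j * (A *v h) $ j) = h \<bullet> (transpose A *v (\<chi> j. f' j))" for h
    by (simp add: inner_commute[of h] dot_lmul_matrix) (simp add: inner_vec_def)
  ultimately show ?thesis
    by (simp add: gderiv_def)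
qed

text \<open>By the chain rule each gradient is \<open>transpose A\<close> applied to the vector of
  scalar derivatives, and moving the transpose across the inner product leaves one scalar term per
  row. Both entropies have this shape; the Burg entropy is the case of matrix \<open>mat 1\<close>
  and shift \<open>\<eta>\<close>.\<close>

lemma D_symm_sum_affine:
  fixes A :: "real ^ 'n ^ 'm" and c :: "real ^ 'm"
  assumes "\<And>j. (f j has_real_derivative f' j ((A *v x) $ j + c $ j)) (at ((A *v x) $ j + c $ j))"
    and "\<And>j. (f j has_real_derivative f' j ((A *v x') $ j + c $ j)) (at ((A *v x') $ j + c $ j))"
  shows "D_symm (\<lambda>x. \<Sum>j\<in>UNIV. f j ((A *v x) $ j + c $ j)) x x' =
    (\<Sum>j\<in>UNIV. (f' j ((A *v x') $ j + c $ j) - f' j ((A *v x) $ j + c $ j)) * (A *v (x' - x)) $ j)"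
  unfolding D_symm_def grad_eqI[OF GDERIV_sum_affine, OF assms(1)]
    grad_eqI[OF GDERIV_sum_affine, OF assms(2)] matrix_vector_mult_diff_distrib[symmetric]
  by (simp add: dot_lmul_matrix) (simp add: inner_vec_def)

lemma D_symm_burg_entropy:
  fixes x x' \<eta> :: "real ^ 'n"
  assumes "\<And>i. 0 < x $ i + \<eta> $ i" "\<And>i. 0 < x' $ i + \<eta> $ i"
  shows "D_symm (burg_entropy \<eta>) x x' =
    (\<Sum>i\<in>UNIV. ((x' - x) $ i)\<^sup>2 / ((x $ i + \<eta> $ i) * (x' $ i + \<eta> $ i)))"
proof -
  have d: "((\<lambda>z. - ln z) has_real_derivative - inverse z) (at z)" if "0 < z" for z :: real
    using that by (auto intro!: derivative_eq_intros simp: field_simps)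
  have "D_symm (burg_entropy \<eta>) x x' = (\<Sum>i\<in>UNIV.
      (- inverse (x' $ i + \<eta> $ i) - - inverse (x $ i + \<eta> $ i)) * (x' - x) $ i)"
    using D_symm_sum_affine[of "\<lambda>_ z. - ln z" "\<lambda>_ z. - inverse z" "mat 1" x \<eta> x'] d assms
    by (simp add: burg_entropy_def[abs_def])
  also have "\<dots> = (\<Sum>i\<in>UNIV. ((x' - x) $ i)\<^sup>2 / ((x $ i + \<eta> $ i) * (x' $ i + \<eta> $ i)))"
  proof (rule sum.cong)
    fix i
    have "x $ i + \<eta> $ i \<noteq> 0" "x' $ i + \<eta> $ i \<noteq> 0"
      using assms[of i] by auto
    then show "(- inverse (x' $ i + \<eta> $ i) - - inverse (x $ i + \<eta> $ i)) * (x' - x) $ i =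
        ((x' - x) $ i)\<^sup>2 / ((x $ i + \<eta> $ i) * (x' $ i + \<eta> $ i))"
      by (simp add: divide_simps power2_eq_square algebra_simps)
  qed simp
  finally show ?thesis .
qed

lemma has_real_derivative_g_KL:
  assumes "0 < z"
  shows "(g_KL y has_real_derivative 1 - real y / z) (at z)"
\<comment> \<open>For \<open>y = 0\<close> the function is the identity; otherwise
  \<open>y / z\<close> is positive, so the logarithm may be differentiated.\<close>
proof (cases "y = 0")
  case True
  then show ?thesis by (simp add: g_KL_def[abs_def])
next
  case False
  with assms show ?thesis
    unfolding g_KL_def[abs_def]
    by (auto intro!: derivative_eq_intros simp: field_simps power2_eq_square)
qed

text \<open>The linear part of \<open>g_KL\<close> cancels in the difference of derivatives, leaving
  \<open>y / z - y / z'\<close>. Rows with zero count vanish, so exactly the rows appearing in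
  (LRIP) remain.\<close>

lemma D_symm_G_KL:
  fixes A :: "real ^ 'n ^ 'm" and b :: "real ^ 'm"
  assumes "\<And>j. 0 < (A *v x) $ j + b $ j" "\<And>j. 0 < (A *v x') $ j + b $ j"
  shows "D_symm (\<lambda>x. G_KL y b (A *v x)) x x' =
    (\<Sum>j | y $ j \<noteq> 0. real (y $ j) * ((A *v (x' - x)) $ j)\<^sup>2 /
      (((A *v x) $ j + b $ j) * ((A *v x') $ j + b $ j)))"
proof -
  let ?z = "\<lambda>j. (A *v x) $ j + b $ j" and ?z' = "\<lambda>j. (A *v x') $ j + b $ j"
  have "D_symm (\<lambda>x. G_KL y b (A *v x)) x x' = (\<Sum>j\<in>UNIV.
      ((1 - real (y $ j) / ?z' j) - (1 - real (y $ j) / ?z j)) * (A *v (x' - x)) $ j)"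
    unfolding G_KL_def
    by (intro D_symm_sum_affine has_real_derivative_g_KL assms)
  also have "\<dots> = (\<Sum>j\<in>UNIV. real (y $ j) * ((A *v (x' - x)) $ j)\<^sup>2 / (?z j * ?z' j))"
  proof (rule sum.cong)
    fix j
    have "(A *v (x' - x)) $ j = ?z' j - ?z j"
      by (simp add: matrix_vector_mult_diff_distrib)
    moreover have "?z j \<noteq> 0" "?z' j \<noteq> 0"
      using assms[of j] by auto
    ultimately show "((1 - real (y $ j) / ?z' j) - (1 - real (y $ j) / ?z j)) * (A *v (x' - x)) $ j =
        real (y $ j) * ((A *v (x' - x)) $ j)\<^sup>2 / (?z j * ?z' j)"
      by (simp add: divide_simps power2_eq_square) (simp add: algebra_simps)
  qed simp
  also have "\<dots> = (\<Sum>j | y $ j \<noteq> 0. real (y $ j) * ((A *v (x' - x)) $ j)\<^sup>2 / (?z j * ?z' j))"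
    by (rule sum.mono_neutral_right) auto
  finally show ?thesis .
qed

section \<open>Lower bound from (LRIP)\<close>

lemma sum_gram_on:
  "(\<Sum>i\<in>I. \<Sum>k\<in>I. v i * gram_on R B i k * v k) = (\<Sum>j\<in>R. (\<Sum>i\<in>I. B j i * v i)\<^sup>2)"
proof -
  have "(\<Sum>j\<in>R. (\<Sum>i\<in>I. B j i * v i)\<^sup>2) = (\<Sum>j\<in>R. \<Sum>i\<in>I. \<Sum>k\<in>I. v i * (B j i * B j k) * v k)"
    by (simp add: power2_eq_square sum_product mult_ac)
  also have "\<dots> = (\<Sum>i\<in>I. \<Sum>k\<in>I. \<Sum>j\<in>R. v i * (B j i * B j k) * v k)"
    by (subst sum.swap) (intro sum.cong sum.swap refl)
  also have "\<dots> = (\<Sum>i\<in>I. \<Sum>k\<in>I. v i * gram_on R B i k * v k)"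
    by (simp add: gram_on_def sum_distrib_left sum_distrib_right)
  finally show ?thesis by simp
qed

text \<open>The Loewner inequality is tested on the support of \<open>h\<close> with
  \<open>h\<close> itself as test vector. The Gram form is then a sum of squares of row products,
  and dropping the columns where \<open>h\<close> vanishes changes neither \<open>A *v h\<close> nor
  the norm.\<close>

lemma LRIP_lower_bound:
  fixes A :: "real ^ 'n ^ 'm"
  assumes "LRIP R UNIV (\<lambda>j i. A $ j $ i) K \<delta>" "l0_norm h \<le> K"
  shows "(1 - \<delta>) * (norm h)\<^sup>2 \<le> (\<Sum>j\<in>R. ((A *v h) $ j)\<^sup>2)"
proof -
  define I where "I = {i. h $ i \<noteq> 0}"
  have "0 \<le> (\<Sum>i\<in>I. \<Sum>k\<in>I. h $ i *
      (gram_on R (\<lambda>j i. A $ j $ i) i k - (1 - \<delta>) * (if i = k then 1 else 0)) * h $ k)"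
    using assms by (auto simp: LRIP_def loewner_ge_on_def pos_semidef_on_def l0_norm_def I_def)
  also have "\<dots> = (\<Sum>i\<in>I. \<Sum>k\<in>I. h $ i * gram_on R (\<lambda>j i. A $ j $ i) i k * h $ k)
      - (\<Sum>i\<in>I. \<Sum>k\<in>I. if i = k then (1 - \<delta>) * (h $ i)\<^sup>2 else 0)"
    unfolding sum_subtractf[symmetric]
    by (intro sum.cong) (auto simp: algebra_simps power2_eq_square)
  also have "\<dots> = (\<Sum>j\<in>R. (\<Sum>i\<in>I. A $ j $ i * h $ i)\<^sup>2) - (\<Sum>i\<in>I. (1 - \<delta>) * (h $ i)\<^sup>2)"
    by (simp add: sum_gram_on)
  also have "(\<Sum>i\<in>I. (1 - \<delta>) * (h $ i)\<^sup>2) = (\<Sum>i\<in>UNIV. (1 - \<delta>) * (h $ i)\<^sup>2)"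
    by (rule sum.mono_neutral_left) (auto simp: I_def)
  also have "\<dots> = (1 - \<delta>) * (norm h)\<^sup>2"
    by (simp add: norm_vec_def L2_set_def sum_nonneg sum_distrib_left)
  finally have "(1 - \<delta>) * (norm h)\<^sup>2 \<le> (\<Sum>j\<in>R. (\<Sum>i\<in>I. A $ j $ i * h $ i)\<^sup>2)"
    by simp
  moreover have "(\<Sum>i\<in>I. A $ j $ i * h $ i) = (A *v h) $ j" for j
    unfolding matrix_vector_mult_def vec_lambda_beta
    by (rule sum.mono_neutral_left) (auto simp: I_def)
  ultimately show ?thesis by simp
qed

section \<open>Comparison of both divergences with a common quantity\<close>

text \<open>Lets a single coordinate of the difference be replaced by the full norm. Clearing
  denominators leaves \<open>s\<^sup>2 + s\<^sup>2 * t \<le> t\<^sup>2 + s * t\<^sup>2\<close>,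
  which holds summand by summand.\<close>

lemma square_div_one_plus_mono:
  fixes s t :: real
  assumes "0 \<le> s" "s \<le> t"
  shows "s\<^sup>2 / (1 + s) \<le> t\<^sup>2 / (1 + t)"
proof -
  have "s * s \<le> t * t" "s * t * s \<le> s * t * t"
    using assms by (auto intro: mult_mono mult_left_mono)
  then show ?thesis
    using assms by (simp add: divide_simps power2_eq_square algebra_simps)
qed

lemma D_symm_burg_entropy_le:
  fixes \<eta> :: "real ^ 'n"
  assumes eta: "\<And>i. e \<le> \<eta> $ i" and "0 < e"
    and x: "x \<in> nonneg_orthant" and x': "x' \<in> nonneg_orthant" and "norm x \<le> R"
  shows "D_symm (burg_entropy \<eta>) x x' \<le>
    real CARD('n) * (((R + 1) / e + 1) / e) * ((norm (x' - x))\<^sup>2 / (1 + norm (x' - x)))"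
proof -
  define h where "h = x' - x"
  \<comment> \<open>Chosen so that \<open>c * (x' $ i + \<eta> $ i)\<close> dominates
    \<open>1 + \<bar>h $ i\<bar>\<close>, which is at most \<open>x' $ i + (R + 1)\<close>: the
    summand \<open>1\<close> absorbs \<open>x' $ i\<close>, and \<open>(R + 1) / e\<close> absorbs
    \<open>R + 1\<close> since \<open>x' $ i + \<eta> $ i\<close> is at least
    \<open>e\<close>.\<close>
  define c where "c = (R + 1) / e + 1"
  have nonneg: "0 \<le> x $ i" "0 \<le> x' $ i" for i
    using x x' by (auto simp: nonneg_orthant_def)
  have "0 \<le> R"
    using \<open>norm x \<le> R\<close> norm_ge_zero[of x] by linarith
  then have "0 < c"
    using \<open>0 < e\<close> by (simp add: c_def add_nonneg_pos)
  have pos: "0 < x $ i + \<eta> $ i" "0 < x' $ i + \<eta> $ i" for i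
    using nonneg[of i] eta[of i] \<open>0 < e\<close> by auto
  have "(h $ i)\<^sup>2 / ((x $ i + \<eta> $ i) * (x' $ i + \<eta> $ i)) \<le> c / e * ((norm h)\<^sup>2 / (1 + norm h))" for i
  proof -
    have "\<bar>h $ i\<bar> \<le> x' $ i + R"
      using nonneg[of i] component_le_norm_cart[of x i] \<open>norm x \<le> R\<close> by (simp add: h_def)
    moreover have "R + 1 \<le> (R + 1) / e * (x' $ i + \<eta> $ i)"
      using mult_left_mono[of e "x' $ i + \<eta> $ i" "(R + 1) / e"] \<open>0 \<le> R\<close> \<open>0 < e\<close> nonneg(2)[of i] eta[of i]
      by simp
    ultimately have "1 + \<bar>h $ i\<bar> \<le> c * (x' $ i + \<eta> $ i)"
      using eta[of i] \<open>0 < e\<close> by (simp add: c_def algebra_simps)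
    then have "(1 + \<bar>h $ i\<bar>) / c \<le> x' $ i + \<eta> $ i"
      using \<open>0 < c\<close> by (simp add: divide_le_eq mult.commute)
    then have "e * ((1 + \<bar>h $ i\<bar>) / c) \<le> (x $ i + \<eta> $ i) * (x' $ i + \<eta> $ i)"
      using nonneg[of i] eta[of i] \<open>0 < e\<close> \<open>0 < c\<close> by (intro mult_mono) auto
    then have "(h $ i)\<^sup>2 / ((x $ i + \<eta> $ i) * (x' $ i + \<eta> $ i)) \<le> (h $ i)\<^sup>2 / (e * ((1 + \<bar>h $ i\<bar>) / c))"
      using \<open>0 < e\<close> \<open>0 < c\<close> pos[of i] by (intro divide_left_mono mult_pos_pos) auto
    also have "\<dots> = c / e * (\<bar>h $ i\<bar>\<^sup>2 / (1 + \<bar>h $ i\<bar>))"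
      by simp
    also have "\<dots> \<le> c / e * ((norm h)\<^sup>2 / (1 + norm h))"
      using \<open>0 < e\<close> \<open>0 < c\<close>
      by (intro mult_left_mono square_div_one_plus_mono component_le_norm_cart) auto
    finally show ?thesis .
  qed
  then have "(\<Sum>i\<in>UNIV. (h $ i)\<^sup>2 / ((x $ i + \<eta> $ i) * (x' $ i + \<eta> $ i))) \<le>
      (\<Sum>i\<in>(UNIV :: 'n set). c / e * ((norm h)\<^sup>2 / (1 + norm h)))"
    by (rule sum_mono)
  then show ?thesis
    by (simp add: D_symm_burg_entropy[OF pos] h_def c_def)
qed

text \<open>Only one factor of each denominator may grow, and at most linearly in the distance. All
  denominators therefore share the bound \<open>Z\<^sup>2 * (1 + norm (x' - x))\<close>, which can
  be pulled out before (LRIP) is applied.\<close>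

lemma D_symm_G_KL_ge:
  fixes A :: "real ^ 'n ^ 'm" and b :: "real ^ 'm"
  assumes lrip: "LRIP {j. y $ j \<noteq> 0} UNIV (\<lambda>j i. A $ j $ i) K \<delta>"
    and supp: "l0_norm (x' - x) \<le> K"
    and pos: "\<And>j. 0 < (A *v x) $ j + b $ j" and pos': "\<And>j. 0 < (A *v x') $ j + b $ j"
    and bound: "\<And>j. (A *v x) $ j + b $ j \<le> Z"
    and bound': "\<And>j. (A *v x') $ j + b $ j \<le> Z * (1 + norm (x' - x))"
  shows "(1 - \<delta>) / Z\<^sup>2 * ((norm (x' - x))\<^sup>2 / (1 + norm (x' - x))) \<le>
    D_symm (\<lambda>x. G_KL y b (A *v x)) x x'"
proof -
  define h where "h = x' - x"
  have "0 < Z"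
    using pos bound less_le_trans by blast
  have "(1 - \<delta>) / Z\<^sup>2 * ((norm h)\<^sup>2 / (1 + norm h)) = (1 - \<delta>) * (norm h)\<^sup>2 / (Z * (Z * (1 + norm h)))"
    by (simp add: power2_eq_square mult_ac)
  also have "\<dots> \<le> (\<Sum>j | y $ j \<noteq> 0. ((A *v h) $ j)\<^sup>2) / (Z * (Z * (1 + norm h)))"
    using LRIP_lower_bound[OF lrip supp] \<open>0 < Z\<close>
    by (intro divide_right_mono) (auto simp: h_def)
  also have "\<dots> = (\<Sum>j | y $ j \<noteq> 0. ((A *v h) $ j)\<^sup>2 / (Z * (Z * (1 + norm h))))"
    by (rule sum_divide_distrib)
  also have "\<dots> \<le> (\<Sum>j | y $ j \<noteq> 0. real (y $ j) * ((A *v h) $ j)\<^sup>2 /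
      (((A *v x) $ j + b $ j) * ((A *v x') $ j + b $ j)))"
  proof (rule sum_mono)
    fix j assume "j \<in> {j. y $ j \<noteq> 0}"
    then have "1 * ((A *v h) $ j)\<^sup>2 \<le> real (y $ j) * ((A *v h) $ j)\<^sup>2"
      by (intro mult_right_mono) auto
    moreover have "((A *v x) $ j + b $ j) * ((A *v x') $ j + b $ j) \<le> Z * (Z * (1 + norm h))"
      using pos[of j] pos'[of j] bound[of j] bound'[of j] \<open>0 < Z\<close>
      by (intro mult_mono) (auto simp: h_def)
    ultimately show "((A *v h) $ j)\<^sup>2 / (Z * (Z * (1 + norm h))) \<le> real (y $ j) * ((A *v h) $ j)\<^sup>2 /
        (((A *v x) $ j + b $ j) * ((A *v x') $ j + b $ j))"
      using pos[of j] pos'[of j] by (intro frac_le mult_pos_pos) auto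
  qed
  finally show ?thesis
    by (simp add: D_symm_G_KL[OF pos pos'] h_def)
qed

theorem theorem2p7:
  fixes A :: "real ^ 'n ^ 'm"
    and b :: "real ^ 'm"
    and y :: "nat ^ 'm"
    and \<eta> :: "real ^ 'n"
    and K :: nat
    and \<delta> :: real
    and X :: "(real ^ 'n) set"
  assumes A_nonneg: "\<And>j i. 0 \<le> A $ j $ i"
    and A_columns: "\<And>i. column i A \<noteq> 0"
    and b_pos: "\<And>j. 0 < b $ j"
    and eta_pos: "\<And>i. 0 < \<eta> $ i"
    and K_range: "K \<in> {1..CARD('n)}"
    and lrip: "LRIP {j. y $ j \<noteq> 0} UNIV (\<lambda>j i. A $ j $ i) K \<delta>"
    and X_compact: "compact X"
    and X_nonneg: "X \<subseteq> nonneg_orthant"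
  shows "\<exists>C>0. BRSC (\<lambda>x. G_KL y b (A *v x)) (burg_entropy \<eta>) X K C"
proof -
  obtain R where "0 < R" and R: "\<And>x. x \<in> X \<Longrightarrow> norm x \<le> R"
    using compact_imp_bounded[OF X_compact] unfolding bounded_pos by blast
  obtain L where "0 < L" and L: "\<And>v. norm (A *v v) \<le> norm v * L"
    using bounded_linear.pos_bounded[OF matrix_vector_mul_bounded_linear[of A]] by blast
  define e where "e = Min (range (\<lambda>i. \<eta> $ i))"
  have "0 < e" and e: "e \<le> \<eta> $ i" for i
    using eta_pos by (auto simp: e_def)
  \<comment> \<open>The first two summands bound the components at \<open>x\<close>; the extra
    \<open>L\<close> lets \<open>Z * (1 + t)\<close> also cover the increment \<open>t * L\<close>
    on the way to \<open>x'\<close>.\<close>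
  define Z where "Z = R * L + norm b + L"
  have "0 < Z"
    using \<open>0 < R\<close> \<open>0 < L\<close> by (simp add: Z_def add_pos_nonneg add_nonneg_pos)
  \<comment> \<open>\<open>p\<close> and \<open>q\<close> are the factors of
    \<open>t\<^sup>2 / (1 + t)\<close> in the upper and lower bounds, so the final constant is
    \<open>q / p\<close>.\<close>
  define p where "p = real CARD('n) * (((R + 1) / e + 1) / e)"
  define q where "q = (1 - \<delta>) / Z\<^sup>2"
  have "0 < p"
    using \<open>0 < R\<close> \<open>0 < e\<close> by (simp add: p_def add_nonneg_pos)
  have "0 < q"
    using lrip \<open>0 < Z\<close> by (simp add: q_def LRIP_def)
  have pos: "0 < (A *v x) $ j + b $ j" if "x \<in> nonneg_orthant" for x j
    using that A_nonneg b_pos[of j]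
    by (auto simp: nonneg_orthant_def matrix_vector_mult_def intro!: add_nonneg_pos sum_nonneg)
  have "q / p * D_symm (burg_entropy \<eta>) x x' \<le> D_symm (\<lambda>x. G_KL y b (A *v x)) x x'"
    if x: "x \<in> X" and x': "x' \<in> nonneg_orthant" and supp: "l0_norm (x - x') \<le> K" for x x'
  proof -
    define t where "t = norm (x' - x)"
    have nonneg: "x \<in> nonneg_orthant"
      using x X_nonneg by blast
    have comp_le: "(A *v v) $ j \<le> norm v * L" for v j
      using component_le_norm_cart[of "A *v v" j] L[of v] by linarith
    have z: "(A *v x) $ j + b $ j \<le> R * L + norm b" for j
      using comp_le[of x j] mult_right_mono[OF R[OF x], of L] \<open>0 < L\<close>
        component_le_norm_cart[of b j] by linarith
    have zZ: "(A *v x) $ j + b $ j \<le> Z" for j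
      using z[of j] \<open>0 < L\<close> by (simp add: Z_def)
    have z': "(A *v x') $ j + b $ j \<le> Z * (1 + t)" for j
    proof -
      have "(A *v x') $ j = (A *v x) $ j + (A *v (x' - x)) $ j"
        by (simp add: matrix_vector_mult_diff_distrib)
      then have "(A *v x') $ j + b $ j \<le> R * L + norm b + t * L"
        using z[of j] comp_le[of "x' - x" j] by (simp add: t_def)
      also have "\<dots> \<le> Z * (1 + t)"
        using \<open>0 < R\<close> \<open>0 < L\<close> by (simp add: Z_def t_def algebra_simps)
      finally show ?thesis .
    qed
    \<comment> \<open>\<open>BRSC\<close> counts the support of \<open>x - x'\<close>, while the
      bounds are phrased with \<open>x' - x\<close>.\<close>
    have "{i. (x' - x) $ i \<noteq> 0} = {i. (x - x') $ i \<noteq> 0}"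
      by auto
    then have "l0_norm (x' - x) \<le> K"
      using supp by (simp only: l0_norm_def)
    then have "q * (t\<^sup>2 / (1 + t)) \<le> D_symm (\<lambda>x. G_KL y b (A *v x)) x x'"
      unfolding q_def t_def
      by (intro D_symm_G_KL_ge[OF lrip _ pos pos] nonneg x' zZ z'[unfolded t_def])
    moreover have "D_symm (burg_entropy \<eta>) x x' \<le> p * (t\<^sup>2 / (1 + t))"
      unfolding p_def t_def by (intro D_symm_burg_entropy_le e \<open>0 < e\<close> nonneg x' R x)
    then have "q / p * D_symm (burg_entropy \<eta>) x x' \<le> q / p * (p * (t\<^sup>2 / (1 + t)))"
      using \<open>0 < p\<close> \<open>0 < q\<close> by (intro mult_left_mono) auto
    then have "q / p * D_symm (burg_entropy \<eta>) x x' \<le> q * (t\<^sup>2 / (1 + t))"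
      using \<open>0 < p\<close> by simp
    ultimately show ?thesis by linarith
  qed
  then have "BRSC (\<lambda>x. G_KL y b (A *v x)) (burg_entropy \<eta>) X K (q / p)"
    by (auto simp: BRSC_def)
  then show ?thesis
    using \<open>0 < p\<close> \<open>0 < q\<close> divide_pos_pos by blast
qed

end
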